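(* Assume $\theta_{T1}/\theta_{T2}>\theta_{L1}/\theta_{L2}>\theta_{K1}/\theta_{K2}$, $\theta_{L1}>\theta_{L2}$, $P=p_1^*-p_2^*>0$, $w_T^*>w_L^*>w_K^*$, and that $(a_{T0}',a_{K0}',a_{L0}')$ has sign pattern $(+,+,-)$. Let $$A=\left(\frac{-W_{TL}}{W_{KL}},\ \frac{\theta_L}{\theta_K}\frac{-W_{LT}}{W_{KT}}\right),\qquad B=\left(\frac{a_{K0}'}{a_{T0}'}\frac{\theta_K}{\theta_T},\ \frac{a_{K0}'}{a_{L0}'}\right).$$ (i) If $$\frac{\theta_{K2}}{\theta_{T2}}<\frac{-W_{TL}}{W_{KL}}<S'<\frac{a_{K0}'}{a_{T0}'}\frac{\theta_K}{\theta_T},$$ then $A$, $B$ and the EWS-ratio vector $(S',U')$ lie in subregion P1. A sufficient condition for this chain is $\frac{\theta_{K2}}{\theta_{T2}}<\frac{-W_{TL}}{W_{KL}}$, which is equivalent to $w_L^*-p_2^*<0$. (ii) If $$\frac{\theta_{K1}}{\theta_{T1}}<\frac{-W_{TL}}{W_{KL}}<S'<\frac{a_{K0}'}{a_{T0}'}\frac{\theta_K}{\theta_T}<\frac{\theta_{K2}}{\theta_{T2}},$$ then $A$, $B$ and $(S',U')$ lie in subregion P2. A sufficient condition for this chain is the set of conditions: $\frac{-W_{TL}}{W_{KL}}<\frac{\theta_{K2}}{\theta_{T2}}$, which is equivalent to $w_L^*-p_2^*>0$; $\frac{\theta_{K1}}{\theta_{T1}}<\frac{-W_{TL}}{W_{KL}}$,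 which is equivalent to $w_L^*-p_1^*<0$; and $\frac{a_{K0}'}{a_{T0}'}\frac{\theta_K}{\theta_T}<\frac{\theta_{K2}}{\theta_{T2}}$. (iii) If $$\frac{-W_{TL}}{W_{KL}}<S'<\frac{a_{K0}'}{a_{T0}'}\frac{\theta_K}{\theta_T}<\frac{\theta_{K1}}{\theta_{T1}},$$ then $A$, $B$ and $(S',U')$ lie in subregion P3. A sufficient condition for this chain is the set of conditions: $\frac{-W_{TL}}{W_{KL}}<\frac{\theta_{K1}}{\theta_{T1}}$, which is equivalent to $w_L^*-p_1^*>0$; and $\frac{a_{K0}'}{a_{T0}'}\frac{\theta_K}{\theta_T}<\frac{\theta_{K1}}{\theta_{T1}}$.
   Context: Two goods $j=1,2$ and three factors $i\in\{T,K,L\}$ (land, capital, labor). All prices $w_i$ (factors), $p_j$ (goods), outputs $X_j$, supplies $V_i$ and input-output coefficients $a_{ij}$ are positive. Production functions are homogeneous of degree one and strictly quasi-concave, so $a_{ij}$ is the cost-minimizing input of $i$ per unit of $j$, a smooth function of $(w_T,w_K,w_L)$, homogeneous of degree zero. The equilibrium conditions are $\sum_j a_{ij}X_j=V_i$ and $\sum_i a_{ij}w_i=p_j$. An asterisk denotes a proportional change along a differential change of the equilibrium ($x^*=dx/x$). Shares: $\theta_{ij}=a_{ij}w_i/p_j$ (so $\sum_i\theta_{ij}=1$); $\lambda_{ij}=a_{ij}X_j/V_i$ (so $\sum_j\lambda_{ij}=1$); with $I=\sum_j p_jX_j$, $\theta_j=p_jX_j/I$ and $\theta_i=w_iV_i/I$.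 All are positive. Differentiated system: $\sum_i\theta_{ij}w_i^*=p_j^*$; $\sum_i\theta_{ij}a_{ij}^*=0$; $a_{ij}^*=\sum_h\varepsilon^{ij}_h w_h^*$ with $\varepsilon^{ij}_h=\theta_{hj}\sigma^{ij}_h$, where the Allen partial elasticities satisfy $\sigma^{ij}_h=\sigma^{hj}_i$, $\sigma^{ij}_i<0$, $\sum_h\theta_{hj}\sigma^{ij}_h=0$. Economy-wide substitution (EWS): $g_{ih}=\sum_j\lambda_{ij}\varepsilon^{ij}_h$. These satisfy $\sum_h g_{ih}=0$, $g_{ih}=(\theta_h/\theta_i)g_{hi}$, $g_{ii}<0$, and (by strict quasi-concavity) $g_{KK}g_{TT}-g_{TK}g_{KT}>0$. The EWS-ratio vector is $(S',U')=(g_{LK}/g_{LT},\,g_{KT}/g_{LT})$. Other notation: $W_{ih}=w_i^*-w_h^*$; $a_{i0}'=\sum_j\lambda_{ij}a_{ij}^*$. Subregions. The curve $U'=-\frac{\theta_L}{\theta_K}\frac{S'}{S'+1}$ is the EWS-ratio vector boundary. Put $Q=\left(\frac{\theta_{K1}-\theta_{K2}}{\theta_{T1}-\theta_{T2}},\ \frac{\theta_{K1}-\theta_{K2}}{\theta_{L1}-\theta_{L2}}\frac{\theta_L}{\theta_K}\right)$, $R_{L2}=\left(\frac{\theta_{K1}}{\theta_{T1}},\frac{-\theta_{K1}}{1-\theta_{L1}}\frac{\theta_L}{\theta_K}\right)$ and $R_{L1}=\left(\frac{\theta_{K2}}{\theta_{T2}},\frac{-\theta_{K2}}{1-\theta_{L2}}\frac{\theta_L}{\theta_K}\right)$;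 all three lie on the boundary. Within the part of quadrant IV ($S'>0>U'$) on or above the boundary, the lines $QR_{L1}$ and $QR_{L2}$ separate the subregions: P1 is the part to the right of line $QR_{L1}$, P2 the part between the two lines, and P3 the part to the left of line $QR_{L2}$. *)

theory Defs
  imports "HOL-Analysis.Analysis"
begin

datatype factor = T | K | L

datatype good = G1 | G2

lemma UNIV_factor: "(UNIV :: factor set) = {T, K, L}"
  using factor.exhaust by auto

lemma UNIV_good: "(UNIV :: good set) = {G1, G2}"
  using good.exhaust by auto

instance factor :: finite
  by standard (simp add: UNIV_factor)

instance good :: finite
  by standard (simp add: UNIV_good)

definition pos_orthant :: "(real ^ 'n) set" where
  "pos_orthant = {x. \<forall>i. 0 < x $ i}"

text \<open>For open \<open>S\<close>, \<open>Ck_on k f S\<close> says that \<open>f\<close> is \<open>k\<close> times continuously differentiable on \<open>S\<close>.\<close>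

primrec Ck_on :: "nat \<Rightarrow> ('a::real_normed_vector \<Rightarrow> real) \<Rightarrow> 'a set \<Rightarrow> bool" where
  "Ck_on 0 f S \<longleftrightarrow> continuous_on S f"
| "Ck_on (Suc k) f S \<longleftrightarrow>
     f differentiable_on S \<and> (\<forall>v. Ck_on k (\<lambda>x. frechet_derivative f (at x) v) S)"

definition smooth_on :: "('a::real_normed_vector \<Rightarrow> real) \<Rightarrow> 'a set \<Rightarrow> bool" where
  "smooth_on f S \<longleftrightarrow> (\<forall>k. Ck_on k f S)"

definition homogeneous_deg1_on :: "('a::real_vector) set \<Rightarrow> ('a \<Rightarrow> real) \<Rightarrow> bool" where
  "homogeneous_deg1_on S f \<longleftrightarrow> (\<forall>x\<in>S. \<forall>c>0. f (c *\<^sub>R x) = c * f x)"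

definition strictly_quasiconcave_on :: "('a::real_vector) set \<Rightarrow> ('a \<Rightarrow> real) \<Rightarrow> bool" where
  "strictly_quasiconcave_on S f \<longleftrightarrow>
     (\<forall>x\<in>S. \<forall>y\<in>S. \<forall>u. x \<noteq> y \<and> 0 < u \<and> u < 1 \<longrightarrow>
        min (f x) (f y) < f ((1 - u) *\<^sub>R x + u *\<^sub>R y))"

text \<open>
  An economy moving along a one-parameter family of equilibria.  The parameter value \<open>0\<close>
  is the equilibrium under consideration, and the tangent of the family there is the
  differential change; every asterisked quantity is a logarithmic derivative at \<open>0\<close>.
  The component \<open>coef E j v $ i\<close> is the input \<open>a\<^sub>i\<^sub>j\<close> of factor \<open>i\<close> per unit of good \<open>j\<close>
  at factor prices \<open>v\<close>.
\<close>

record economy =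
  production :: "good \<Rightarrow> real ^ factor \<Rightarrow> real"
  coef :: "good \<Rightarrow> real ^ factor \<Rightarrow> real ^ factor"
  wage :: "real \<Rightarrow> real ^ factor"
  price :: "real \<Rightarrow> real ^ good"
  outp :: "real \<Rightarrow> real ^ good"
  endow :: "real \<Rightarrow> real ^ factor"

definition technology :: "economy \<Rightarrow> bool" where
  "technology E \<longleftrightarrow> (\<forall>j.
     homogeneous_deg1_on pos_orthant (production E j) \<and>
     strictly_quasiconcave_on pos_orthant (production E j) \<and>
     (\<forall>v\<in>pos_orthant. is_arg_min (\<lambda>x. v \<bullet> x)
        (\<lambda>x. x \<in> pos_orthant \<and> production E j x = 1) (coef E j v)) \<and>
     (\<forall>i. smooth_on (\<lambda>v. coef E j v $ i) pos_orthant))"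

definition equilibrium_at :: "economy \<Rightarrow> real \<Rightarrow> bool" where
  "equilibrium_at E t \<longleftrightarrow>
     wage E t \<in> pos_orthant \<and> price E t \<in> pos_orthant \<and>
     outp E t \<in> pos_orthant \<and> endow E t \<in> pos_orthant \<and>
     (\<forall>i. (\<Sum>j\<in>UNIV. coef E j (wage E t) $ i * outp E t $ j) = endow E t $ i) \<and>
     (\<forall>j. (\<Sum>i\<in>UNIV. coef E j (wage E t) $ i * wage E t $ i) = price E t $ j)"

definition pchange :: "(real \<Rightarrow> real) \<Rightarrow> real" where
  "pchange x = deriv x 0 / x 0"

definition w_star :: "economy \<Rightarrow> factor \<Rightarrow> real" where
  "w_star E i = pchange (\<lambda>t. wage E t $ i)"

definition p_star :: "economy \<Rightarrow> good \<Rightarrow> real" where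
  "p_star E j = pchange (\<lambda>t. price E t $ j)"

definition a_star :: "economy \<Rightarrow> factor \<Rightarrow> good \<Rightarrow> real" where
  "a_star E i j = pchange (\<lambda>t. coef E j (wage E t) $ i)"

definition coef0 :: "economy \<Rightarrow> factor \<Rightarrow> good \<Rightarrow> real" where
  "coef0 E i j = coef E j (wage E 0) $ i"

definition theta :: "economy \<Rightarrow> factor \<Rightarrow> good \<Rightarrow> real" where
  "theta E i j = coef0 E i j * wage E 0 $ i / price E 0 $ j"

definition lam :: "economy \<Rightarrow> factor \<Rightarrow> good \<Rightarrow> real" where
  "lam E i j = coef0 E i j * outp E 0 $ j / endow E 0 $ i"

definition income :: "economy \<Rightarrow> real" where
  "income E = (\<Sum>j\<in>UNIV. price E 0 $ j * outp E 0 $ j)"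

definition factor_share :: "economy \<Rightarrow> factor \<Rightarrow> real" where
  "factor_share E i = wage E 0 $ i * endow E 0 $ i / income E"

text \<open>\<open>elast E i j h\<close> is \<open>\<partial> log a\<^sub>i\<^sub>j / \<partial> log w\<^sub>h\<close>; \<open>allen E i j h\<close> is the
  Allen partial elasticity between the factors \<open>i\<close> and \<open>h\<close> in sector \<open>j\<close>.\<close>

definition elast :: "economy \<Rightarrow> factor \<Rightarrow> good \<Rightarrow> factor \<Rightarrow> real" where
  "elast E i j h =
     wage E 0 $ h / coef0 E i j *
     frechet_derivative (\<lambda>v. coef E j v $ i) (at (wage E 0)) (axis h 1)"

definition allen :: "economy \<Rightarrow> factor \<Rightarrow> good \<Rightarrow> factor \<Rightarrow> real" where
  "allen E i j h = elast E i j h / theta E h j"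

definition ews :: "economy \<Rightarrow> factor \<Rightarrow> factor \<Rightarrow> real" where
  "ews E i h = (\<Sum>j\<in>UNIV. lam E i j * elast E i j h)"

text \<open>
  The last two clauses are second-order regularity conditions.  Strict quasi-concavity only gives the corresponding weak inequalities
  (the Hessian of a unit cost function may degenerate at a point), so they are required
  explicitly.  The other properties of the elasticities (symmetry, vanishing weighted sums)
  and the differentiated system follow from the remaining clauses.
\<close>

definition equilibrium_change :: "economy \<Rightarrow> bool" where
  "equilibrium_change E \<longleftrightarrow>
     technology E \<and>
     (\<forall>\<^sub>F t in nhds 0. equilibrium_at E t) \<and>
     wage E differentiable at 0 \<and> price E differentiable at 0 \<and>
     outp E differentiable at 0 \<and> endow E differentiable at 0 \<and>
     (\<forall>i j. allen E i j i < 0) \<and>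
     ews E K K * ews E T T - ews E T K * ews E K T > 0"

definition S_ratio :: "economy \<Rightarrow> real" where
  "S_ratio E = ews E L K / ews E L T"

definition U_ratio :: "economy \<Rightarrow> real" where
  "U_ratio E = ews E K T / ews E L T"

definition W :: "economy \<Rightarrow> factor \<Rightarrow> factor \<Rightarrow> real" where
  "W E i h = w_star E i - w_star E h"

definition a0 :: "economy \<Rightarrow> factor \<Rightarrow> real" where
  "a0 E i = (\<Sum>j\<in>UNIV. lam E i j * a_star E i j)"

definition point_Q :: "economy \<Rightarrow> real \<times> real" where
  "point_Q E =
     ((theta E K G1 - theta E K G2) / (theta E T G1 - theta E T G2),
      (theta E K G1 - theta E K G2) / (theta E L G1 - theta E L G2)
        * (factor_share E L / factor_share E K))"

definition point_RL2 :: "economy \<Rightarrow> real \<times> real" where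
  "point_RL2 E =
     (theta E K G1 / theta E T G1,
      - theta E K G1 / (1 - theta E L G1) * (factor_share E L / factor_share E K))"

definition point_RL1 :: "economy \<Rightarrow> real \<times> real" where
  "point_RL1 E =
     (theta E K G2 / theta E T G2,
      - theta E K G2 / (1 - theta E L G2) * (factor_share E L / factor_share E K))"

definition region_IV :: "economy \<Rightarrow> (real \<times> real) set" where
  "region_IV E = {(S, U). S > 0 \<and> U < 0 \<and>
     U \<ge> - (factor_share E L / factor_share E K) * (S / (S + 1))}"

text \<open>A point is to the right (left) of a line if the line has a point at the same height
  with smaller (larger) abscissa.\<close>

definition right_of :: "(real \<times> real) set \<Rightarrow> (real \<times> real) set" where
  "right_of l = {z. \<exists>m\<in>l. snd m = snd z \<and> fst m < fst z}"

definition left_of :: "(real \<times> real) set \<Rightarrow> (real \<times> real) set" where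
  "left_of l = {z. \<exists>m\<in>l. snd m = snd z \<and> fst z < fst m}"

definition line_QRL1 :: "economy \<Rightarrow> (real \<times> real) set" where
  "line_QRL1 E = affine hull {point_Q E, point_RL1 E}"

definition line_QRL2 :: "economy \<Rightarrow> (real \<times> real) set" where
  "line_QRL2 E = affine hull {point_Q E, point_RL2 E}"

definition P1 :: "economy \<Rightarrow> (real \<times> real) set" where
  "P1 E = region_IV E \<inter> right_of (line_QRL1 E)"

definition P2 :: "economy \<Rightarrow> (real \<times> real) set" where
  "P2 E = region_IV E \<inter> left_of (line_QRL1 E) \<inter> right_of (line_QRL2 E)"

definition P3 :: "economy \<Rightarrow> (real \<times> real) set" where
  "P3 E = region_IV E \<inter> left_of (line_QRL2 E)"

definition point_A :: "economy \<Rightarrow> real \<times> real" where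
  "point_A E =
     (- W E T L / W E K L, factor_share E L / factor_share E K * (- W E L T / W E K T))"

definition point_B :: "economy \<Rightarrow> real \<times> real" where
  "point_B E =
     (a0 E K / a0 E T * (factor_share E K / factor_share E T), a0 E K / a0 E L)"

end

theory Submission
  imports Defs
begin

text \<open>
  Cost minimization gives \<open>\<Sum>\<^sub>i w\<^sub>i da\<^sub>i\<^sub>j = 0\<close>, so the input coefficients are the gradient of the
  unit cost function; by the symmetry of its second derivatives the weighted EWS terms
  \<open>\<theta>\<^sub>i g\<^sub>i\<^sub>h\<close> form a symmetric matrix with zero row sums.  Write \<open>c\<close>, \<open>d\<close>, \<open>e\<close> for its
  entries \<open>LT\<close>, \<open>LK\<close>, \<open>KT\<close> and \<open>x = W\<^sub>T\<^sub>L\<close>, \<open>y = W\<^sub>L\<^sub>K\<close>.  The sign pattern \<open>(+,+,-)\<close> forces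
  \<open>c, d > 0 > e\<close> and \<open>x / y < d / c\<close>, and the determinant condition \<open>cd + ce + de > 0\<close> says both
  that \<open>(S', U')\<close> lies above the boundary and that \<open>S'\<close> is smaller than the abscissa of \<open>B\<close>.  Thus
  the chain of inequalities between the abscissae of \<open>A\<close>, \<open>(S', U')\<close> and \<open>B\<close> always holds.  Since
  \<open>A\<close> and \<open>B\<close> lie on the falling boundary and \<open>U'\<close> lies between their ordinates, comparing
  abscissae with those of \<open>R\<^sub>L\<^sub>1\<close> and \<open>R\<^sub>L\<^sub>2\<close> places all three points relative to the rising lines
  \<open>QR\<^sub>L\<^sub>1\<close> and \<open>QR\<^sub>L\<^sub>2\<close>.
\<close>

subsection \<open>Symmetry of second derivatives\<close>

text \<open>The mean value theorem in direction \<open>h\<close> turns the second difference of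
  \<open>c\<close> over the parallelogram spanned by \<open>t *\<^sub>R h\<close> and
  \<open>t *\<^sub>R k\<close> into an increment of the gradient \<open>a\<close>, which the linear
  approximation at \<open>w\<close> evaluates.\<close>

lemma mixed_difference_estimate:
  fixes c :: "'a::real_inner \<Rightarrow> real"
  assumes ball: "\<And>y. norm (y - w) < d \<Longrightarrow> (c has_derivative (\<lambda>v. v \<bullet> a y)) (at y)"
    and approx: "\<And>y. norm (y - w) < d \<Longrightarrow> norm (a y - a w - D (y - w)) \<le> e * norm (y - w)"
    and D: "bounded_linear D" and "0 < e" and "0 < t" and small: "t * (norm h + norm k) < d"
  shows "\<bar>c (w + t *\<^sub>R h + t *\<^sub>R k) - c (w + t *\<^sub>R h) - c (w + t *\<^sub>R k) + c w - t\<^sup>2 * (h \<bullet> D k)\<bar>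
    \<le> t\<^sup>2 * (2 * e * (norm h + norm k)\<^sup>2)"
proof -
  interpret D: bounded_linear D by fact
  let ?N = "norm h + norm k"
  \<comment> \<open>Increment of \<open>c\<close> along \<open>t *\<^sub>R k\<close> from the moving
    base point, so that \<open>g t - g 0\<close> is the whole second difference.\<close>
  define g where "g s = c (w + s *\<^sub>R h + t *\<^sub>R k) - c (w + s *\<^sub>R h)" for s
  have seg: "norm (s *\<^sub>R h + r *\<^sub>R k) \<le> t * ?N" if "0 \<le> s" "s \<le> t" "0 \<le> r" "r \<le> t" for s r
  proof -
    have "norm (s *\<^sub>R h + r *\<^sub>R k) \<le> s * norm h + r * norm k"
      using norm_triangle_ineq[of "s *\<^sub>R h" "r *\<^sub>R k"] that by simp
    also have "\<dots> \<le> t * norm h + t * norm k"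
      using that by (intro add_mono mult_right_mono) auto
    finally show ?thesis by (simp add: distrib_left)
  qed
  have near: "norm ((w + s *\<^sub>R h + t *\<^sub>R k) - w) < d" "norm ((w + s *\<^sub>R h) - w) < d"
    if "0 \<le> s" "s \<le> t" for s
    using seg[of s t] seg[of s 0] small \<open>0 < t\<close> that by (auto simp: algebra_simps)
  have "\<exists>s\<in>{0<..<t}. g t - g 0 =
      (\<lambda>r. r * (h \<bullet> (a (w + s *\<^sub>R h + t *\<^sub>R k) - a (w + s *\<^sub>R h)))) (t - 0)"
  proof (rule mvt_simple[OF \<open>0 < t\<close>])
    fix s assume s: "0 \<le> s" "s \<le> t"
    have lin: "((\<lambda>s. w + s *\<^sub>R h + u) has_derivative (\<lambda>r. r *\<^sub>R h)) (at s within {0..t})" for u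
      by (auto intro!: derivative_eq_intros)
    have "((\<lambda>s. c (w + s *\<^sub>R h + t *\<^sub>R k)) has_derivative
        (\<lambda>r. (r *\<^sub>R h) \<bullet> a (w + s *\<^sub>R h + t *\<^sub>R k))) (at s within {0..t})"
      by (rule has_derivative_compose[OF lin ball[OF near(1)[OF s]]])
    moreover have "((\<lambda>s. c (w + s *\<^sub>R h)) has_derivative
        (\<lambda>r. (r *\<^sub>R h) \<bullet> a (w + s *\<^sub>R h))) (at s within {0..t})"
      using has_derivative_compose[OF lin[of 0, simplified] ball[OF near(2)[OF s]]] by simp
    ultimately show "(g has_derivative
        (\<lambda>r. r * (h \<bullet> (a (w + s *\<^sub>R h + t *\<^sub>R k) - a (w + s *\<^sub>R h))))) (at s within {0..t})"
      unfolding g_def by (auto intro!: derivative_eq_intros simp: algebra_simps inner_diff_right)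
  qed
  then obtain s where s: "0 < s" "s < t"
    and gs: "g t - g 0 = t * (h \<bullet> (a (w + s *\<^sub>R h + t *\<^sub>R k) - a (w + s *\<^sub>R h)))"
    by auto
  \<comment> \<open>Error in replacing the gradient increment by \<open>t *\<^sub>R D k\<close>.
    Both end points are compared with \<open>a w\<close>, which produces the factor 2.\<close>
  define r where "r = a (w + s *\<^sub>R h + t *\<^sub>R k) - a (w + s *\<^sub>R h) - t *\<^sub>R D k"
  have "norm (a (w + s *\<^sub>R h + t *\<^sub>R k) - a w - D (s *\<^sub>R h + t *\<^sub>R k))
      \<le> e * norm (s *\<^sub>R h + t *\<^sub>R k)"
    using approx[OF near(1)[of s]] s by (simp add: add.assoc)
  also have "\<dots> \<le> e * (t * ?N)"
    using seg[of s t] s \<open>0 < e\<close> by (intro mult_left_mono) auto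
  finally have r1: "norm (a (w + s *\<^sub>R h + t *\<^sub>R k) - a w - D (s *\<^sub>R h + t *\<^sub>R k)) \<le> e * (t * ?N)" .
  have "norm (a (w + s *\<^sub>R h) - a w - D (s *\<^sub>R h)) \<le> e * norm (s *\<^sub>R h)"
    using approx[OF near(2)[of s]] s by simp
  also have "\<dots> \<le> e * (t * ?N)"
    using seg[of s 0] s \<open>0 < e\<close> by (intro mult_left_mono) auto
  finally have r2: "norm (a (w + s *\<^sub>R h) - a w - D (s *\<^sub>R h)) \<le> e * (t * ?N)" .
  have "r = (a (w + s *\<^sub>R h + t *\<^sub>R k) - a w - D (s *\<^sub>R h + t *\<^sub>R k))
      - (a (w + s *\<^sub>R h) - a w - D (s *\<^sub>R h))"
    by (simp add: r_def D.add D.scaleR)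
  then have "norm r \<le> 2 * (e * (t * ?N))"
    using norm_triangle_ineq4 r1 r2 by (smt (verit))
  then have "\<bar>h \<bullet> r\<bar> \<le> norm h * (2 * (e * (t * ?N)))"
    using Cauchy_Schwarz_ineq2[of h r] by (meson mult_left_mono norm_ge_zero order_trans)
  also have "\<dots> \<le> ?N * (2 * (e * (t * ?N)))"
    using \<open>0 < t\<close> \<open>0 < e\<close> by (intro mult_right_mono) auto
  finally have hr: "t * \<bar>h \<bullet> r\<bar> \<le> t * (?N * (2 * (e * (t * ?N))))"
    using \<open>0 < t\<close> by (intro mult_left_mono) auto
  have "g t - g 0 - t\<^sup>2 * (h \<bullet> D k) = t * (h \<bullet> r)"
    by (simp add: gs r_def inner_diff_right power2_eq_square algebra_simps)
  then have "\<bar>g t - g 0 - t\<^sup>2 * (h \<bullet> D k)\<bar> \<le> t\<^sup>2 * (2 * e * ?N\<^sup>2)"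
    using hr \<open>0 < t\<close> by (simp add: abs_mult power2_eq_square algebra_simps)
  then show ?thesis
    by (simp add: g_def algebra_simps)
qed

text \<open>The second difference is unchanged when \<open>h\<close> and \<open>k\<close> are
  swapped, so it is close to both \<open>t\<^sup>2 * (h \<bullet> D k)\<close> and
  \<open>t\<^sup>2 * (k \<bullet> D h)\<close>; dividing by \<open>t\<^sup>2\<close> leaves a gap
  proportional to an arbitrary \<open>e\<close>.\<close>

lemma gradient_derivative_symmetric:
  fixes c :: "'a::real_inner \<Rightarrow> real"
  assumes S: "open S" "w \<in> S"
    and grad: "\<And>y. y \<in> S \<Longrightarrow> (c has_derivative (\<lambda>v. v \<bullet> a y)) (at y)"
    and D: "(a has_derivative D) (at w)"
  shows "h \<bullet> D k = k \<bullet> D h"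
proof -
  define N where "N = norm h + norm k"
  have "\<bar>h \<bullet> D k - k \<bullet> D h\<bar> \<le> e * (4 * N\<^sup>2)" if "0 < e" for e
  proof -
    obtain d1 where "0 < d1"
      and d1: "\<And>y. norm (y - w) < d1 \<Longrightarrow> norm (a y - a w - D (y - w)) \<le> e * norm (y - w)"
      using D \<open>0 < e\<close> unfolding has_derivative_at_alt by blast
    obtain d2 where "0 < d2" and d2: "ball w d2 \<subseteq> S"
      using S open_contains_ball by blast
    define d where "d = min d1 d2"
    have "0 < d" using \<open>0 < d1\<close> \<open>0 < d2\<close> by (simp add: d_def)
    have "0 \<le> N" by (simp add: N_def)
    \<comment> \<open>The added 1 keeps the divisor positive when \<open>h\<close> and
      \<open>k\<close> both vanish.\<close>
    define t where "t = d / (N + 1)"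
    have t: "0 < t" "t * N < d"
      using \<open>0 < d\<close> \<open>0 \<le> N\<close> by (auto simp: t_def field_simps)
    have ball: "(c has_derivative (\<lambda>v. v \<bullet> a y)) (at y)" if "norm (y - w) < d" for y
      using that d2 by (intro grad) (auto simp: d_def dist_norm norm_minus_commute)
    have approx: "norm (a y - a w - D (y - w)) \<le> e * norm (y - w)" if "norm (y - w) < d" for y
      using d1 that by (simp add: d_def)
    note est = mixed_difference_estimate[OF ball approx has_derivative_bounded_linear[OF D] \<open>0 < e\<close> t(1)]
    have "\<bar>c (w + t *\<^sub>R h + t *\<^sub>R k) - c (w + t *\<^sub>R h) - c (w + t *\<^sub>R k) + c w - t\<^sup>2 * (h \<bullet> D k)\<bar>
        \<le> t\<^sup>2 * (2 * e * N\<^sup>2)"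
      using est[where h=h and k=k] t by (simp add: N_def)
    moreover have "\<bar>c (w + t *\<^sub>R h + t *\<^sub>R k) - c (w + t *\<^sub>R h) - c (w + t *\<^sub>R k) + c w - t\<^sup>2 * (k \<bullet> D h)\<bar>
        \<le> t\<^sup>2 * (2 * e * N\<^sup>2)"
      using est[where h=k and k=h] t by (simp add: N_def algebra_simps)
    ultimately have "\<bar>t\<^sup>2 * (h \<bullet> D k) - t\<^sup>2 * (k \<bullet> D h)\<bar> \<le> 2 * (t\<^sup>2 * (2 * e * N\<^sup>2))"
      by linarith
    then have "t\<^sup>2 * \<bar>h \<bullet> D k - k \<bullet> D h\<bar> \<le> t\<^sup>2 * (e * (4 * N\<^sup>2))"
      by (simp add: abs_mult flip: right_diff_distrib)
    then show ?thesis
      using t(1) by simp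
  qed
  note le = this
  have "\<bar>h \<bullet> D k - k \<bullet> D h\<bar> \<le> 0 + e" if "0 < e" for e
  proof -
    have pos: "0 < 4 * N\<^sup>2 + 1"
      by (simp add: add_nonneg_pos)
    have "\<bar>h \<bullet> D k - k \<bullet> D h\<bar> \<le> e / (4 * N\<^sup>2 + 1) * (4 * N\<^sup>2)"
      using that pos by (intro le) simp
    also have "\<dots> \<le> e / (4 * N\<^sup>2 + 1) * (4 * N\<^sup>2 + 1)"
      using that pos by (intro mult_left_mono) auto
    finally show ?thesis using pos by simp
  qed
  then have "\<bar>h \<bullet> D k - k \<bullet> D h\<bar> \<le> 0"
    by (rule field_le_epsilon)
  then show ?thesis by simp
qed

subsection \<open>Cost minimization and factor substitution\<close>

lemma sum_factor: "sum f (UNIV :: factor set) = f T + f K + f L"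
  by (simp add: UNIV_factor add.assoc)

lemma sum_good: "sum f (UNIV :: good set) = f G1 + f G2"
  by (simp add: UNIV_good)

lemma open_pos_orthant: "open (pos_orthant :: (real ^ 'n) set)"
proof -
  have eq: "(pos_orthant :: (real ^ 'n) set) = (\<Inter>i. {x. 0 < x $ i})"
    by (auto simp: pos_orthant_def)
  show ?thesis
    unfolding eq by (intro open_INT ballI finite open_Collect_less continuous_intros)
qed

lemma coef_has_derivative:
  assumes "technology E" and "v \<in> pos_orthant"
  shows "(coef E j has_derivative frechet_derivative (coef E j) (at v)) (at v)"
proof -
  have "(\<lambda>u. coef E j u $ i) differentiable (at v)" for i
  proof -
    have "Ck_on (Suc 0) (\<lambda>u. coef E j u $ i) pos_orthant"
      using assms unfolding technology_def smooth_on_def by blast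
    then show ?thesis
      using assms(2) open_pos_orthant
      by (metis Ck_on.simps(2) differentiable_on_eq_differentiable_at)
  qed
  then have "coef E j differentiable (at v)"
    by (subst differentiable_componentwise_within) (auto simp: Basis_vec_def inner_axis)
  then show ?thesis
    by (simp add: frechet_derivative_works)
qed

text \<open>With prices held at \<open>v\<close>, the input vectors chosen at other prices remain
  feasible, so their cost is minimal at \<open>u = v\<close> and its derivative there is
  zero.\<close>

lemma cost_envelope:
  assumes E: "technology E" and v: "v \<in> pos_orthant"
  shows "v \<bullet> frechet_derivative (coef E j) (at v) h = 0"
proof -
  have amin: "is_arg_min (\<lambda>x. u \<bullet> x) (\<lambda>x. x \<in> pos_orthant \<and> production E j x = 1) (coef E j u)"
    if "u \<in> pos_orthant" for u
    using E that unfolding technology_def by blast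
  have min: "\<forall>u\<in>pos_orthant. v \<bullet> coef E j v \<le> v \<bullet> coef E j u"
    using amin amin[OF v] by (auto simp: is_arg_min_def not_less)
  have "((\<lambda>u. v \<bullet> coef E j u) has_derivative (\<lambda>h. v \<bullet> frechet_derivative (coef E j) (at v) h)) (at v)"
    by (intro has_derivative_inner_right coef_has_derivative E v)
  then have "(\<lambda>h. v \<bullet> frechet_derivative (coef E j) (at v) h) = (\<lambda>h. 0)"
    using min by (intro differential_zero_maxmin[OF v open_pos_orthant]) auto
  then show ?thesis
    by metis
qed

text \<open>The product rule gives two terms; the one that varies the inputs vanishes by the
  envelope property.\<close>

lemma shephard:
  assumes "technology E" and "v \<in> pos_orthant"
  shows "((\<lambda>u. u \<bullet> coef E j u) has_derivative (\<lambda>h. h \<bullet> coef E j v)) (at v)"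
  using has_derivative_inner[OF has_derivative_ident coef_has_derivative[OF assms, of j]]
  by (simp add: cost_envelope[OF assms])

lemma coef_derivative_symmetric:
  assumes "technology E" and "v \<in> pos_orthant"
  shows "h \<bullet> frechet_derivative (coef E j) (at v) k = k \<bullet> frechet_derivative (coef E j) (at v) h"
  by (rule gradient_derivative_symmetric[OF open_pos_orthant assms(2) shephard[OF assms(1)]
        coef_has_derivative[OF assms]])

text \<open>Infinitesimal form of homogeneity of degree zero. With \<open>D\<close> the derivative,
  symmetry gives \<open>D v \<bullet> D v = v \<bullet> D (D v)\<close>, which is zero by the
  envelope property.\<close>

lemma coef_derivative_self:
  assumes "technology E" and "v \<in> pos_orthant"
  shows "frechet_derivative (coef E j) (at v) v = 0"
  using coef_derivative_symmetric[OF assms, of "frechet_derivative (coef E j) (at v) v" j v]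
    cost_envelope[OF assms] by simp

section \<open>Positivity and shares at the equilibrium\<close>

lemma equilibrium_change_technology: "equilibrium_change E \<Longrightarrow> technology E"
  by (simp add: equilibrium_change_def)

lemma equilibrium_now:
  assumes "equilibrium_change E"
  shows "equilibrium_at E 0"
  using assms eventually_nhds_x_imp_x unfolding equilibrium_change_def by blast

lemma wage_in_pos_orthant: "equilibrium_change E \<Longrightarrow> wage E 0 \<in> pos_orthant"
  using equilibrium_now by (auto simp: equilibrium_at_def)

lemma equilibrium_positive:
  assumes "equilibrium_change E"
  shows "0 < wage E 0 $ i" "0 < price E 0 $ j" "0 < outp E 0 $ j" "0 < endow E 0 $ i"
    "0 < coef0 E i j"
proof -
  show "0 < wage E 0 $ i" "0 < price E 0 $ j" "0 < outp E 0 $ j" "0 < endow E 0 $ i"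
    using equilibrium_now[OF assms] by (auto simp: equilibrium_at_def pos_orthant_def)
  have "is_arg_min (\<lambda>x. wage E 0 \<bullet> x) (\<lambda>x. x \<in> pos_orthant \<and> production E j x = 1)
      (coef E j (wage E 0))"
    using equilibrium_change_technology[OF assms] wage_in_pos_orthant[OF assms]
    unfolding technology_def by blast
  then show "0 < coef0 E i j"
    by (auto simp: is_arg_min_def pos_orthant_def coef0_def)
qed

lemma income_positive: "equilibrium_change E \<Longrightarrow> 0 < income E"
  by (simp add: income_def sum_good equilibrium_positive add_pos_pos)

lemma shares_positive:
  assumes "equilibrium_change E"
  shows "0 < theta E i j" "0 < lam E i j" "0 < factor_share E i"
  using equilibrium_positive[OF assms] income_positive[OF assms]
  by (simp_all add: theta_def lam_def factor_share_def)

lemma theta_sum: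
  assumes "equilibrium_change E"
  shows "theta E T j + theta E K j + theta E L j = 1"
proof -
  have "(\<Sum>i\<in>UNIV. coef0 E i j * wage E 0 $ i) = price E 0 $ j"
    using equilibrium_now[OF assms] by (simp add: equilibrium_at_def coef0_def)
  then show ?thesis
    using equilibrium_positive(2)[OF assms, of j]
    by (simp add: theta_def sum_factor flip: add_divide_distrib)
qed

text \<open>Passes from the derivative of one component to a component of the derivative of the
  vector map, to which the symmetry result applies.\<close>

lemma elast_eq:
  assumes "equilibrium_change E"
  shows "elast E i j h = wage E 0 $ h / coef0 E i j *
    frechet_derivative (coef E j) (at (wage E 0)) (axis h 1) $ i"
proof -
  have "((\<lambda>v. coef E j v $ i) has_derivative
      (\<lambda>u. frechet_derivative (coef E j) (at (wage E 0)) u $ i)) (at (wage E 0))"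
    by (rule bounded_linear.has_derivative[OF bounded_linear_vec_nth coef_has_derivative])
      (use assms in \<open>simp_all add: equilibrium_change_technology wage_in_pos_orthant\<close>)
  from frechet_derivative_at[OF this, symmetric] show ?thesis
    by (simp add: elast_def)
qed

lemma linear_axis_sum:
  fixes f :: "real ^ 'n \<Rightarrow> 'b::real_vector"
  assumes "linear f"
  shows "f x = (\<Sum>h\<in>UNIV. x $ h *\<^sub>R f (axis h 1))"
proof -
  have "f x = f (\<Sum>h\<in>UNIV. x $ h *\<^sub>R axis h 1)"
    using basis_expansion[of x] by (simp add: scalar_mult_eq_scaleR)
  then show ?thesis
    by (simp add: linear_sum[OF assms] linear_scale[OF assms])
qed

lemma linear_coef_derivative:
  assumes "equilibrium_change E"
  shows "linear (frechet_derivative (coef E j) (at (wage E 0)))"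
  using coef_has_derivative[OF equilibrium_change_technology[OF assms] wage_in_pos_orthant[OF assms]]
  by (rule has_derivative_linear)

section \<open>The share-weighted EWS matrix\<close>

text \<open>The weight turns the relation \<open>g_ih = (theta_h / theta_i) g_hi\<close> into plain
  symmetry of a matrix.\<close>

definition ews_weighted :: "economy \<Rightarrow> factor \<Rightarrow> factor \<Rightarrow> real" where
  "ews_weighted E i h = factor_share E i * ews E i h"

text \<open>Supplies and input coefficients cancel, leaving Hessian entries of the unit costs scaled
  symmetrically by the two wages.\<close>

lemma ews_weighted_eq:
  assumes "equilibrium_change E"
  shows "ews_weighted E i h = (\<Sum>j\<in>UNIV. outp E 0 $ j / income E * (wage E 0 $ i *
    (wage E 0 $ h * frechet_derivative (coef E j) (at (wage E 0)) (axis h 1) $ i)))"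
  unfolding ews_weighted_def ews_def sum_distrib_left
  using equilibrium_positive[OF assms, THEN less_imp_neq] income_positive[OF assms]
  by (intro sum.cong refl) (simp add: elast_eq[OF assms] lam_def factor_share_def field_simps)

lemma ews_weighted_symmetric:
  assumes "equilibrium_change E"
  shows "ews_weighted E i h = ews_weighted E h i"
proof -
  have "frechet_derivative (coef E j) (at (wage E 0)) (axis h 1) $ i
      = frechet_derivative (coef E j) (at (wage E 0)) (axis i 1) $ h" for j
    using coef_derivative_symmetric[OF equilibrium_change_technology[OF assms]
        wage_in_pos_orthant[OF assms], of "axis i 1" j "axis h 1"]
    by (simp add: inner_axis')
  then show ?thesis
    by (simp add: ews_weighted_eq[OF assms] mult.left_commute)
qed

text \<open>Within each sector, the wage-weighted sum over \<open>h\<close> is the derivative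
  applied to the wage vector itself, which vanishes.\<close>

lemma ews_weighted_sum:
  assumes "equilibrium_change E"
  shows "(\<Sum>h\<in>UNIV. ews_weighted E i h) = 0"
proof -
  have "(\<Sum>h\<in>UNIV. wage E 0 $ h * frechet_derivative (coef E j) (at (wage E 0)) (axis h 1) $ i) = 0"
    for j
  proof -
    have "(\<Sum>h\<in>UNIV. wage E 0 $ h *\<^sub>R frechet_derivative (coef E j) (at (wage E 0)) (axis h 1)) = 0"
      using linear_axis_sum[OF linear_coef_derivative[OF assms], of j "wage E 0"]
        coef_derivative_self[OF equilibrium_change_technology[OF assms] wage_in_pos_orthant[OF assms], of j]
      by simp
    from arg_cong[OF this, of "\<lambda>x. x $ i"] show ?thesis
      by simp
  qed
  then show ?thesis
    unfolding ews_weighted_eq[OF assms]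
    by (subst sum.swap) (simp del: times_divide_eq_left flip: sum_distrib_left)
qed

lemma ews_own_negative:
  assumes "equilibrium_change E"
  shows "ews E i i < 0"
proof -
  have "elast E i j i < 0" for j
  proof -
    have "allen E i j i < 0"
      using assms unfolding equilibrium_change_def by blast
    then show ?thesis
      using shares_positive(1)[OF assms, of i j] by (auto simp: allen_def divide_less_0_iff)
  qed
  then show ?thesis
    using shares_positive(2)[OF assms]
    by (simp add: ews_def sum_good add_neg_neg mult_pos_neg)
qed

section \<open>Differentiation along the family of equilibria\<close>

lemma has_real_derivative_vec_nth:
  assumes "(f has_vector_derivative d) (at t)"
  shows "((\<lambda>s. f s $ i) has_real_derivative d $ i) (at t)"
  using bounded_linear.has_vector_derivative[OF bounded_linear_vec_nth assms]
  by (simp add: has_real_derivative_iff_has_vector_derivative)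

lemma wage_has_vector_derivative:
  assumes "equilibrium_change E"
  shows "(wage E has_vector_derivative vector_derivative (wage E) (at 0)) (at 0)"
  using assms by (simp add: equilibrium_change_def vector_derivative_works)

lemma wage_derivative_nth:
  assumes "equilibrium_change E"
  shows "vector_derivative (wage E) (at 0) $ i = wage E 0 $ i * w_star E i"
  using has_real_derivative_vec_nth[OF wage_has_vector_derivative[OF assms], THEN DERIV_imp_deriv]
    equilibrium_positive(1)[OF assms, of i]
  by (simp add: w_star_def pchange_def)

lemma a_star_eq:
  assumes "equilibrium_change E"
  shows "a_star E i j = (\<Sum>h\<in>UNIV. elast E i j h * w_star E h)"
proof -
  let ?D = "frechet_derivative (coef E j) (at (wage E 0))"
  let ?d = "vector_derivative (wage E) (at 0)"
  have "((\<lambda>t. coef E j (wage E t)) has_vector_derivative ?D ?d) (at 0)"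
    using vector_derivative_diff_chain_within[of "wage E" ?d 0 UNIV "coef E j" ?D]
      wage_has_vector_derivative[OF assms]
      coef_has_derivative[OF equilibrium_change_technology[OF assms] wage_in_pos_orthant[OF assms], of j]
    by (simp add: o_def has_derivative_at_withinI)
  then have "deriv (\<lambda>t. coef E j (wage E t) $ i) 0 = ?D ?d $ i"
    by (intro DERIV_imp_deriv has_real_derivative_vec_nth)
  also have "\<dots> = (\<Sum>h\<in>UNIV. wage E 0 $ h * w_star E h * ?D (axis h 1) $ i)"
    by (subst linear_axis_sum[OF linear_coef_derivative[OF assms]])
      (simp add: wage_derivative_nth[OF assms])
  finally show ?thesis
    by (simp add: a_star_def pchange_def elast_eq[OF assms] coef0_def sum_divide_distrib mult_ac)
qed

text \<open>By Shephard's lemma the input adjustments drop out of the change in unit cost, so only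
  the share-weighted wage changes remain.\<close>

lemma p_star_eq:
  assumes "equilibrium_change E"
  shows "p_star E j = (\<Sum>i\<in>UNIV. theta E i j * w_star E i)"
proof -
  let ?d = "vector_derivative (wage E) (at 0)"
  have "((\<lambda>t. wage E t \<bullet> coef E j (wage E t)) has_vector_derivative ?d \<bullet> coef E j (wage E 0)) (at 0)"
    using vector_derivative_diff_chain_within[of "wage E" ?d 0 UNIV "\<lambda>v. v \<bullet> coef E j v"
        "\<lambda>h. h \<bullet> coef E j (wage E 0)"] wage_has_vector_derivative[OF assms]
      shephard[OF equilibrium_change_technology[OF assms] wage_in_pos_orthant[OF assms], of j]
    by (simp add: o_def has_derivative_at_withinI)
  then have "deriv (\<lambda>t. wage E t \<bullet> coef E j (wage E t)) 0 = ?d \<bullet> coef E j (wage E 0)"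
    by (intro DERIV_imp_deriv) (simp add: has_real_derivative_iff_has_vector_derivative)
  \<comment> \<open>Zero profit holds on a whole neighborhood of 0, so it may be differentiated
    there.\<close>
  moreover have "\<forall>\<^sub>F t in nhds 0. price E t $ j = wage E t \<bullet> coef E j (wage E t)"
    using assms unfolding equilibrium_change_def
    by (auto elim!: eventually_mono simp: equilibrium_at_def inner_vec_def mult.commute)
  ultimately have "deriv (\<lambda>t. price E t $ j) 0 = ?d \<bullet> coef E j (wage E 0)"
    using deriv_cong_ev by metis
  then show ?thesis
    by (simp add: p_star_def pchange_def inner_vec_def wage_derivative_nth[OF assms] theta_def
        coef0_def sum_divide_distrib mult_ac)
qed

lemma a0_eq:
  assumes "equilibrium_change E"
  shows "factor_share E i * a0 E i = (\<Sum>h\<in>UNIV. ews_weighted E i h * w_star E h)"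
  by (simp add: a0_def a_star_eq[OF assms] ews_weighted_def ews_def sum_factor sum_good algebra_simps)

subsection \<open>The boundary and the subregions\<close>

text \<open>The parameter \<open>s\<close> solves the linear equation for height
  \<open>y\<close>.\<close>

lemma two_point_line_at_height:
  fixes q r :: "real \<times> real" and y :: real
  assumes "snd q < snd r"
  defines "s \<equiv> (y - snd q) / (snd r - snd q)"
  shows "q + s *\<^sub>R (r - q) \<in> affine hull {q, r}" "snd (q + s *\<^sub>R (r - q)) = y"
  using assms(1) by (auto simp: affine_hull_2_alt s_def)

text \<open>At or below the height of \<open>r\<close> the parameter is at most 1, so the point of
  the line is no farther right than \<open>r\<close>.\<close>

lemma right_of_rising_line:
  fixes q r z :: "real \<times> real"
  assumes q: "fst q < fst r" "snd q < snd r" and z: "fst r < fst z" "snd z \<le> snd r"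
  shows "z \<in> right_of (affine hull {q, r})"
proof -
  define s where "s = (snd z - snd q) / (snd r - snd q)"
  have "s \<le> 1"
    using q z by (simp add: s_def)
  then have "s * (fst r - fst q) \<le> 1 * (fst r - fst q)"
    using q by (intro mult_right_mono) auto
  then have "fst (q + s *\<^sub>R (r - q)) < fst z"
    using z by simp
  then show ?thesis
    using two_point_line_at_height[OF q(2), of "snd z", folded s_def] unfolding right_of_def by blast
qed

lemma left_of_rising_line:
  fixes q r z :: "real \<times> real"
  assumes q: "fst q < fst r" "snd q < snd r" and z: "fst z < fst r" "snd r \<le> snd z"
  shows "z \<in> left_of (affine hull {q, r})"
proof -
  define s where "s = (snd z - snd q) / (snd r - snd q)"
  have "1 \<le> s"
    using q z by (simp add: s_def)
  then have "1 * (fst r - fst q) \<le> s * (fst r - fst q)"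
    using q by (intro mult_right_mono) auto
  then have "fst z < fst (q + s *\<^sub>R (r - q))"
    using z by simp
  then show ?thesis
    using two_point_line_at_height[OF q(2), of "snd z", folded s_def] unfolding left_of_def by blast
qed

definition ews_boundary :: "economy \<Rightarrow> real \<Rightarrow> real" where
  "ews_boundary E S = - (factor_share E L / factor_share E K) * (S / (S + 1))"

lemma ews_boundary_antimono:
  assumes "equilibrium_change E" and "0 \<le> S" and "S \<le> S'"
  shows "ews_boundary E S' \<le> ews_boundary E S"
proof -
  have "S / (S + 1) \<le> S' / (S' + 1)"
    using assms by (simp add: field_simps)
  from mult_left_mono[OF this, of "factor_share E L / factor_share E K"] show ?thesis
    using shares_positive(3)[OF assms(1)] by (simp add: ews_boundary_def less_imp_le)
qed

text \<open>\<open>Q\<close> lies on the lower left branch of the boundary hyperbola, so the lines from \<open>Q\<close>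
  to points of the upper right branch rise.\<close>

lemma point_Q_bounds:
  assumes "equilibrium_change E"
    and ranking: "theta E T G1 / theta E T G2 > theta E L G1 / theta E L G2"
    and labor: "theta E L G1 > theta E L G2"
  shows "fst (point_Q E) < 0" "snd (point_Q E) < - (factor_share E L / factor_share E K)"
proof -
  note pos = shares_positive[OF assms(1)]
  \<comment> \<open>Good 1 has the larger labor share and, by the ranking, the larger land share;
    since shares sum to one, its capital share is smaller.\<close>
  have "1 < theta E L G1 / theta E L G2"
    using labor pos by simp
  also note ranking
  finally have T: "theta E T G2 < theta E T G1"
    using pos by simp
  have K: "theta E K G1 - theta E K G2
      = - (theta E T G1 - theta E T G2) - (theta E L G1 - theta E L G2)"
    using theta_sum[OF assms(1), of G1] theta_sum[OF assms(1), of G2] by linarith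
  show "fst (point_Q E) < 0"
    using K T labor by (simp add: point_Q_def divide_neg_pos)
  have "(theta E K G1 - theta E K G2) / (theta E L G1 - theta E L G2) < -1"
    using K T labor by (simp add: pos_divide_less_eq)
  from mult_strict_right_mono[OF this, of "factor_share E L / factor_share E K"]
  show "snd (point_Q E) < - (factor_share E L / factor_share E K)"
    using pos(3) by (simp add: point_Q_def)
qed

text \<open>Since \<open>1 - theta E L j\<close> is the land share plus the capital share, dividing
  by the land share gives the form \<open>S / (S + 1)\<close>.\<close>

lemma point_RL_on_boundary:
  assumes "equilibrium_change E"
  shows "point_RL2 E = (theta E K G1 / theta E T G1, ews_boundary E (theta E K G1 / theta E T G1))"
    and "point_RL1 E = (theta E K G2 / theta E T G2, ews_boundary E (theta E K G2 / theta E T G2))"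
proof -
  have "- theta E K j / (1 - theta E L j) * (factor_share E L / factor_share E K)
      = ews_boundary E (theta E K j / theta E T j)" for j
  proof -
    have "1 - theta E L j = theta E T j + theta E K j"
      using theta_sum[OF assms, of j] by linarith
    moreover have "theta E K j / theta E T j / (theta E K j / theta E T j + 1)
        = theta E K j / (theta E T j + theta E K j)"
      using shares_positive(1)[OF assms, of T j] by (simp add: field_simps)
    ultimately show ?thesis
      unfolding ews_boundary_def by (simp only:) (simp add: mult.commute)
  qed
  then show "point_RL2 E = (theta E K G1 / theta E T G1, ews_boundary E (theta E K G1 / theta E T G1))"
    and "point_RL1 E = (theta E K G2 / theta E T G2, ews_boundary E (theta E K G2 / theta E T G2))"
    by (simp_all add: point_RL1_def point_RL2_def)
qed

text \<open>The bound is the horizontal asymptote. It separates \<open>point_Q\<close>, which lies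
  below it, from the boundary points with nonnegative abscissa.\<close>

lemma ews_boundary_lower_bound:
  assumes "equilibrium_change E" and "0 \<le> S"
  shows "- (factor_share E L / factor_share E K) < ews_boundary E S"
proof -
  have "S / (S + 1) < 1"
    using assms by simp
  from mult_strict_left_mono[OF this, of "factor_share E L / factor_share E K"] show ?thesis
    using shares_positive(3)[OF assms(1)] by (simp add: ews_boundary_def)
qed

section \<open>Consequences of the sign pattern\<close>

lemma substitution_signs:
  fixes c d e x y :: real
  assumes "0 < x" "0 < y"
    and diag: "0 < c + e" "0 < d + e" and det: "0 < c * d + c * e + d * e"
    and T: "e * (x + y) + c * x < 0" and K: "0 < e * (x + y) + d * y" and L: "c * x - d * y < 0"
  shows "0 < c"
    and "x / y < d / c"
    and "d / c < (e * (x + y) + d * y) / - (e * (x + y) + c * x)"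
    and "- (d / c / (d / c + 1)) \<le> e / c"
    and "e / c \<le> - (x / y / (x / y + 1))"
proof -
  \<comment> \<open>If \<open>c \<le> 0\<close>, then \<open>c + e > 0\<close> forces
    \<open>e > 0\<close>, and the expression in \<open>T\<close> would be positive.\<close>
  show c: "0 < c"
  proof (rule ccontr)
    assume "\<not> 0 < c"
    then have "0 < e" using diag by linarith
    then have "0 < e * y + (c + e) * x"
      using assms by (simp add: add_pos_pos)
    with T show False by (simp add: algebra_simps)
  qed
  show "x / y < d / c"
    using L c \<open>0 < y\<close> by (simp add: field_simps)
  have "0 < c * x / y" "c * x / y < d"
    using L c assms(1,2) by (simp_all add: field_simps)
  then have d: "0 < d" by linarith
  \<comment> \<open>The product equals
    \<open>c * (e * (x + y) + d * y) + d * (e * (x + y) + c * x)\<close>, so its positivity is the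
    cross-multiplied bound on \<open>d / c\<close>.\<close>
  have "0 < (x + y) * (c * d + c * e + d * e)"
    using det assms(1,2) by simp
  then have "d * - (e * (x + y) + c * x) < (e * (x + y) + d * y) * c"
    by (simp add: algebra_simps)
  then show "d / c < (e * (x + y) + d * y) / - (e * (x + y) + c * x)"
    using c T by (simp only: frac_less_eq divide_less_eq less_divide_eq) (simp add: field_simps)
  have "d / c / (d / c + 1) = d / (c + d)" "x / y / (x / y + 1) = x / (x + y)"
    using c d assms(1,2) by (simp_all add: field_simps)
  \<comment> \<open>Clearing denominators reduces this to the determinant condition; the next bound
    reduces to \<open>T\<close>.\<close>
  moreover have "- (d / (c + d)) \<le> e / c"
    using c d det by (simp add: field_simps)
  moreover have "e / c \<le> - (x / (x + y))"
    using c T assms(1,2) by (simp add: field_simps)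
  ultimately show "- (d / c / (d / c + 1)) \<le> e / c" "e / c \<le> - (x / y / (x / y + 1))"
    by (simp_all only:)
qed

lemma ews_ratio_chain:
  assumes E: "equilibrium_change E"
    and w: "w_star E T > w_star E L" "w_star E L > w_star E K"
    and a: "a0 E T > 0" "a0 E K > 0" "a0 E L < 0"
  defines "SA \<equiv> - W E T L / W E K L"
    and "SB \<equiv> a0 E K / a0 E T * (factor_share E K / factor_share E T)"
  shows "0 < SA" "SA < S_ratio E" "S_ratio E < SB"
    and "point_A E = (SA, ews_boundary E SA)" "point_B E = (SB, ews_boundary E SB)"
    and "ews_boundary E (S_ratio E) \<le> U_ratio E" "U_ratio E \<le> ews_boundary E SA"
proof -
  note pos = shares_positive(3)[OF E]
  define r where "r = factor_share E L / factor_share E K"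
  have r: "0 < r" using pos by (simp add: r_def)
  define x y where "x = w_star E T - w_star E L" and "y = w_star E L - w_star E K"
  define c d e where "c = ews_weighted E L T" and "d = ews_weighted E L K" and "e = ews_weighted E K T"
  have x: "0 < x" and y: "0 < y" using w by (simp_all add: x_def y_def)
  note sym = ews_weighted_symmetric[OF E]
  have off: "ews_weighted E T L = c" "ews_weighted E K L = d" "ews_weighted E T K = e"
    "ews_weighted E L T = c" "ews_weighted E L K = d" "ews_weighted E K T = e"
    by (simp_all add: c_def d_def e_def sym[of T] sym[of K L])
  have diag: "ews_weighted E T T = - (c + e)" "ews_weighted E K K = - (d + e)"
    "ews_weighted E L L = - (c + d)"
    using ews_weighted_sum[OF E, of T] ews_weighted_sum[OF E, of K] ews_weighted_sum[OF E, of L]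
    by (simp_all add: sum_factor off)
  have g: "ews E i h = ews_weighted E i h / factor_share E i" for i h
    using pos[of i] by (simp add: ews_weighted_def)
  \<comment> \<open>Rows sum to zero, so only wage differences enter: \<open>x\<close>,
    \<open>y\<close>, and \<open>x + y\<close> for the gap between land and capital.\<close>
  have a0: "factor_share E T * a0 E T = - (e * (x + y) + c * x)"
    "factor_share E K * a0 E K = e * (x + y) + d * y"
    "factor_share E L * a0 E L = c * x - d * y"
    unfolding a0_eq[OF E] sum_factor off diag x_def y_def by algebra+
  have diag_pos: "0 < c + e" "0 < d + e"
    using ews_own_negative[OF E, of T] ews_own_negative[OF E, of K] pos[of T] pos[of K]
    by (simp_all add: g diag divide_less_0_iff)
  \<comment> \<open>Dividing out the shares leaves \<open>(d + e) * (c + e) - e * e\<close>, which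
    is \<open>c * d + c * e + d * e\<close>.\<close>
  have "0 < (ews_weighted E K K * ews_weighted E T T - ews_weighted E T K * ews_weighted E K T)
      / (factor_share E K * factor_share E T)"
    using E by (simp add: equilibrium_change_def g diff_divide_distrib mult.commute)
  then have det: "0 < c * d + c * e + d * e"
    using mult_pos_pos[OF pos[of K] pos[of T]]
    by (simp add: off diag zero_less_divide_iff) (simp add: algebra_simps)
  have aT: "e * (x + y) + c * x < 0" and aK: "0 < e * (x + y) + d * y" and aL: "c * x - d * y < 0"
    using mult_pos_pos[OF pos[of T] a(1)] mult_pos_pos[OF pos[of K] a(2)]
      mult_pos_neg[OF pos[of L] a(3)] by (simp_all add: a0)
  note signs = substitution_signs[OF x y diag_pos det aT aK aL]
  have SA: "SA = x / y"
  proof -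
    have "W E K L = - y" "W E T L = x" by (simp_all add: W_def x_def y_def)
    then show ?thesis by (simp add: SA_def)
  qed
  have S: "S_ratio E = d / c"
    using pos[of L] by (simp add: S_ratio_def g off)
  have U: "U_ratio E = r * (e / c)"
    by (simp add: U_ratio_def g off r_def mult.commute)
  have SB': "SB = (factor_share E K * a0 E K) / (factor_share E T * a0 E T)"
    by (simp add: SB_def mult.commute)
  then have SB: "SB = (e * (x + y) + d * y) / - (e * (x + y) + c * x)"
    by (simp only: a0)
  have boundary: "ews_boundary E z = r * - (z / (z + 1))" for z
    by (simp add: ews_boundary_def r_def)
  show "0 < SA" using x y by (simp add: SA)
  show "SA < S_ratio E" "S_ratio E < SB"
    using signs by (simp_all only: SA S SB)
  show "ews_boundary E (S_ratio E) \<le> U_ratio E" "U_ratio E \<le> ews_boundary E SA"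
    unfolding boundary U S SA using signs(4,5) r by (simp_all only: mult_le_cancel_left_pos)
  have "- W E L T / W E K T = - (x / (x + y))"
  proof -
    have "W E K T = - (x + y)" "W E L T = - x" by (simp_all add: W_def x_def y_def)
    then show ?thesis by (simp only: minus_divide_divide minus_minus divide_minus_right)
  qed
  also have "\<dots> = - (SA / (SA + 1))"
    using x y by (simp add: SA field_simps)
  finally show "point_A E = (SA, ews_boundary E SA)"
    by (simp add: point_A_def boundary r_def SA_def)
  have "a0 E K / a0 E L = r * ((factor_share E K * a0 E K) / (factor_share E L * a0 E L))"
    using pos[of K] pos[of L] by (simp add: r_def)
  also have "\<dots> = r * - (SB / (SB + 1))"
  proof -
    \<comment> \<open>The three weighted changes \<open>factor_share E i * a0 E i\<close> sum to
      zero; this puts \<open>point_B\<close> on the boundary.\<close>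
    have split: "c * x - d * y = (e * (x + y) + c * x) - (e * (x + y) + d * y)" by simp
    have quot: "m / (n - m) = - (m / - n / (m / - n + 1))" if "n < 0" "0 < m" for m n :: real
      using that by (simp add: field_simps)
    show ?thesis
      unfolding a0 SB split using quot[OF aT aK] by simp
  qed
  finally show "point_B E = (SB, ews_boundary E SB)"
    by (simp add: point_B_def boundary SB_def)
qed

lemma wage_price_gap:
  assumes "equilibrium_change E"
  shows "w_star E L - p_star E j
    = theta E K j * (w_star E L - w_star E K) - theta E T j * (w_star E T - w_star E L)"
proof -
  have L: "theta E L j = 1 - theta E T j - theta E K j"
    using theta_sum[OF assms, of j] by linarith
  show ?thesis
    unfolding p_star_eq[OF assms] sum_factor L by (simp add: algebra_simps)
qed

text \<open>Dividing the gap by the positive number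
  \<open>theta E T j * (w_star E L - w_star E K)\<close> leaves the difference of the two compared
  ratios.\<close>

lemma wage_price_gap_sign:
  assumes "equilibrium_change E" and "w_star E L > w_star E K"
  shows "theta E K j / theta E T j < - W E T L / W E K L \<longleftrightarrow> w_star E L - p_star E j < 0"
    and "- W E T L / W E K L < theta E K j / theta E T j \<longleftrightarrow> w_star E L - p_star E j > 0"
proof -
  have "- W E T L / W E K L = (w_star E T - w_star E L) / (w_star E L - w_star E K)"
    unfolding W_def by (metis minus_diff_eq minus_divide_divide minus_minus)
  moreover have "0 < w_star E L - w_star E K"
    using assms(2) by simp
  ultimately show "theta E K j / theta E T j < - W E T L / W E K L \<longleftrightarrow> w_star E L - p_star E j < 0"
    "- W E T L / W E K L < theta E K j / theta E T j \<longleftrightarrow> w_star E L - p_star E j > 0"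
    unfolding wage_price_gap[OF assms(1)] using shares_positive(1)[OF assms(1), of T j]
    by (simp_all only: less_diff_eq diff_less_eq) (simp_all add: divide_simps mult.commute)
qed

section \<open>Location of the three points in the subregions\<close>

theorem corollary1:
  fixes E :: economy
  assumes "equilibrium_change E"
    and "theta E T G1 / theta E T G2 > theta E L G1 / theta E L G2"
    and "theta E L G1 / theta E L G2 > theta E K G1 / theta E K G2"
    and "theta E L G1 > theta E L G2"
    and "p_star E G1 - p_star E G2 > 0"
    and "w_star E T > w_star E L" and "w_star E L > w_star E K"
    and "a0 E T > 0" and "a0 E K > 0" and "a0 E L < 0"
  shows
    "((theta E K G2 / theta E T G2 < - W E T L / W E K L \<and>
       - W E T L / W E K L < S_ratio E \<and>
       S_ratio E < a0 E K / a0 E T * (factor_share E K / factor_share E T)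
         \<longrightarrow> {point_A E, point_B E, (S_ratio E, U_ratio E)} \<subseteq> P1 E) \<and>
      (theta E K G2 / theta E T G2 < - W E T L / W E K L
         \<longrightarrow> theta E K G2 / theta E T G2 < - W E T L / W E K L \<and>
             - W E T L / W E K L < S_ratio E \<and>
             S_ratio E < a0 E K / a0 E T * (factor_share E K / factor_share E T)) \<and>
      (theta E K G2 / theta E T G2 < - W E T L / W E K L
         \<longleftrightarrow> w_star E L - p_star E G2 < 0))
   \<and>
     ((theta E K G1 / theta E T G1 < - W E T L / W E K L \<and>
       - W E T L / W E K L < S_ratio E \<and>
       S_ratio E < a0 E K / a0 E T * (factor_share E K / factor_share E T) \<and>
       a0 E K / a0 E T * (factor_share E K / factor_share E T) < theta E K G2 / theta E T G2
         \<longrightarrow> {point_A E, point_B E, (S_ratio E, U_ratio E)} \<subseteq> P2 E) \<and>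
      (- W E T L / W E K L < theta E K G2 / theta E T G2 \<and>
       theta E K G1 / theta E T G1 < - W E T L / W E K L \<and>
       a0 E K / a0 E T * (factor_share E K / factor_share E T) < theta E K G2 / theta E T G2
         \<longrightarrow> theta E K G1 / theta E T G1 < - W E T L / W E K L \<and>
             - W E T L / W E K L < S_ratio E \<and>
             S_ratio E < a0 E K / a0 E T * (factor_share E K / factor_share E T) \<and>
             a0 E K / a0 E T * (factor_share E K / factor_share E T)
               < theta E K G2 / theta E T G2) \<and>
      (- W E T L / W E K L < theta E K G2 / theta E T G2
         \<longleftrightarrow> w_star E L - p_star E G2 > 0) \<and>
      (theta E K G1 / theta E T G1 < - W E T L / W E K L
         \<longleftrightarrow> w_star E L - p_star E G1 < 0))
   \<and>
     ((- W E T L / W E K L < S_ratio E \<and>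
       S_ratio E < a0 E K / a0 E T * (factor_share E K / factor_share E T) \<and>
       a0 E K / a0 E T * (factor_share E K / factor_share E T) < theta E K G1 / theta E T G1
         \<longrightarrow> {point_A E, point_B E, (S_ratio E, U_ratio E)} \<subseteq> P3 E) \<and>
      (- W E T L / W E K L < theta E K G1 / theta E T G1 \<and>
       a0 E K / a0 E T * (factor_share E K / factor_share E T) < theta E K G1 / theta E T G1
         \<longrightarrow> - W E T L / W E K L < S_ratio E \<and>
             S_ratio E < a0 E K / a0 E T * (factor_share E K / factor_share E T) \<and>
             a0 E K / a0 E T * (factor_share E K / factor_share E T)
               < theta E K G1 / theta E T G1) \<and>
      (- W E T L / W E K L < theta E K G1 / theta E T G1
         \<longleftrightarrow> w_star E L - p_star E G1 > 0))"
proof -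
  note E = assms(1) and ranking = assms(2) and labor = assms(4) and w = assms(6,7) and a = assms(8-10)
  define SA where "SA = - W E T L / W E K L"
  define SB where "SB = a0 E K / a0 E T * (factor_share E K / factor_share E T)"
  note chain = ews_ratio_chain[OF E w a, folded SA_def SB_def]
  \<comment> \<open>All three points lie in one box: abscissae between \<open>SA\<close> and
    \<open>SB\<close>, ordinates between the boundary values there. This lets them be placed
    together.\<close>
  have order: "0 < fst z" "SA \<le> fst z" "fst z \<le> SB"
    "ews_boundary E (fst z) \<le> snd z" "snd z \<le> ews_boundary E SA" "ews_boundary E SB \<le> snd z"
    if "z \<in> {point_A E, point_B E, (S_ratio E, U_ratio E)}" for z
    using that chain ews_boundary_antimono[OF E, of SA SB] ews_boundary_antimono[OF E, of "S_ratio E" SB]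
    by auto
  have ratio: "0 < theta E K j / theta E T j" for j
    using shares_positive(1)[OF E] by simp
  have region: "z \<in> region_IV E" if z: "z \<in> {point_A E, point_B E, (S_ratio E, U_ratio E)}" for z
  proof -
    have "ews_boundary E SA < 0"
      using shares_positive(3)[OF E] chain(1) by (simp add: ews_boundary_def)
    then show ?thesis
      using order[OF z] by (auto simp: region_IV_def ews_boundary_def split: prod.splits)
  qed
  note Q = point_Q_bounds[OF E ranking labor]
  \<comment> \<open>The boundary point over \<open>R\<close> is left of the box and, since the
    boundary falls, not below it; for \<open>R > SB\<close> the positions are reversed.\<close>
  have right: "z \<in> right_of (affine hull {point_Q E, (R, ews_boundary E R)})"
    if z: "z \<in> {point_A E, point_B E, (S_ratio E, U_ratio E)}" and R: "0 < R" "R < SA" for z R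
    using order[OF z] Q R ews_boundary_lower_bound[OF E, of R] ews_boundary_antimono[OF E, of R SA]
    by (intro right_of_rising_line) auto
  have left: "z \<in> left_of (affine hull {point_Q E, (R, ews_boundary E R)})"
    if z: "z \<in> {point_A E, point_B E, (S_ratio E, U_ratio E)}" and R: "SB < R" for z R
    using order[OF z] Q R ews_boundary_lower_bound[OF E, of R] ews_boundary_antimono[OF E, of SB R]
      chain(1-3)
    by (intro left_of_rising_line) auto
  note lines = line_QRL1_def line_QRL2_def point_RL_on_boundary[OF E]
  have i: "{point_A E, point_B E, (S_ratio E, U_ratio E)} \<subseteq> P1 E" if "theta E K G2 / theta E T G2 < SA"
    using region right ratio that unfolding P1_def lines by blast
  have ii: "{point_A E, point_B E, (S_ratio E, U_ratio E)} \<subseteq> P2 E"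
    if "theta E K G1 / theta E T G1 < SA" "SB < theta E K G2 / theta E T G2"
    using region right left ratio that unfolding P2_def lines by blast
  have iii: "{point_A E, point_B E, (S_ratio E, U_ratio E)} \<subseteq> P3 E"
    if "SB < theta E K G1 / theta E T G1"
    using region left that unfolding P3_def lines by blast
  \<comment> \<open>The price conditions are rewritten as ratio comparisons, which makes the
    equivalences trivial; \<open>chain\<close> supplies the middle inequalities.\<close>
  show ?thesis
    unfolding wage_price_gap_sign[OF E w(2), symmetric] SA_def[symmetric] SB_def[symmetric]
    using i ii iii chain(2,3) by blast
qed

end
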